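(* Let $R$ be a $\mathbb{Z}$-torsion free commutative ring and let $c\ge1$ be an integer. For any element $x\in Nr(R)$ such that $\phi(x)$ has the $c$-cycle, the element $x$ has finite support if and only if $x$ belongs to the image of $T_c:Nr(R)\to Nr(R)$.
   Context: A commutative ring $R$ (with $1$) is $\mathbb{Z}$-torsion free if $r\mapsto nr$ is injective on $R$ for every integer $n\ge1$. The necklace ring $Nr(R)$ is the set of infinite vectors $(x_1,x_2,x_3,\ldots)$ with entries in $R$, with componentwise addition and multiplication $(x\cdot_{Nr}y)_n=\sum_{[i,j]=n}(i,j)x_iy_j$, where $(i,j)$ and $[i,j]$ denote gcd and lcm. $R^{\mathbb{N}}$ is the set of the same infinite vectors with componentwise ring operations. The map $\phi:Nr(R)\to R^{\mathbb{N}}$ is $\phi(x)_n=\sum_{d\mid n}d\,x_d$. For $x=(x_1,x_2,\ldots)\in Nr(R)$, $\mathrm{supp}(x)$ is the set of integers $n\ge1$ with $x_n\ne0$; $x$ has finite support if $\mathrm{supp}(x)$ is finite. An element $a=(a_1,a_2,\ldots)\in R^{\mathbb{N}}$ has the $c$-cycle if $a_i=a_j$ for all integers $i\ge j\ge1$ with $c\mid i-j$. The $r$-th truncated operation $T_r:Nr(R)\to Nr(R)$ sends $(x_n)_n$ to $(y_n)_n$ with $y_n=x_n$ if $n\mid r$ and $y_n=0$ if $n\nmid r$. *)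

theory Defs
  imports "HOL-Algebra.Ring"
begin

text \<open>
  Rings are taken as objects (\<^locale>\<open>cring\<close>), so that the zero ring is not excluded, as it would be
  by \<^class>\<open>comm_ring_1\<close>. Infinite vectors \<open>(x\<^sub>1, x\<^sub>2, x\<^sub>3, \<dots>)\<close> are functions on \<^typ>\<open>nat\<close> that are
  \<^const>\<open>undefined\<close> at the non-index 0, so that two of them are equal iff their entries agree.
\<close>

definition Z_torsion_free :: "('a, 'm) ring_scheme \<Rightarrow> bool" where
  "Z_torsion_free R \<longleftrightarrow>
     (\<forall>n::int. n \<ge> 1 \<longrightarrow> inj_on (\<lambda>r. [n] \<cdot>\<^bsub>R\<^esub> r) (carrier R))"

definition infinite_vectors :: "('a, 'm) ring_scheme \<Rightarrow> (nat \<Rightarrow> 'a) set" where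
  "infinite_vectors R = {1..} \<rightarrow>\<^sub>E carrier R"

definition necklace_ring :: "('a, 'm) ring_scheme \<Rightarrow> (nat \<Rightarrow> 'a) ring" where
  "necklace_ring R =
     \<lparr>carrier = infinite_vectors R,
      mult = (\<lambda>x y. \<lambda>n\<in>{1..}.
        finsum R (\<lambda>(i, j). [gcd i j] \<cdot>\<^bsub>R\<^esub> (x i \<otimes>\<^bsub>R\<^esub> y j)) {(i, j). i \<ge> 1 \<and> j \<ge> 1 \<and> lcm i j = n}),
      one = (\<lambda>n\<in>{1..}. if n = 1 then \<one>\<^bsub>R\<^esub> else \<zero>\<^bsub>R\<^esub>),
      zero = (\<lambda>n\<in>{1..}. \<zero>\<^bsub>R\<^esub>),
      add = (\<lambda>x y. \<lambda>n\<in>{1..}. x n \<oplus>\<^bsub>R\<^esub> y n)\<rparr>"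

definition sequence_ring :: "('a, 'm) ring_scheme \<Rightarrow> (nat \<Rightarrow> 'a) ring" where
  "sequence_ring R =
     \<lparr>carrier = infinite_vectors R,
      mult = (\<lambda>x y. \<lambda>n\<in>{1..}. x n \<otimes>\<^bsub>R\<^esub> y n),
      one = (\<lambda>n\<in>{1..}. \<one>\<^bsub>R\<^esub>),
      zero = (\<lambda>n\<in>{1..}. \<zero>\<^bsub>R\<^esub>),
      add = (\<lambda>x y. \<lambda>n\<in>{1..}. x n \<oplus>\<^bsub>R\<^esub> y n)\<rparr>"

definition necklace_phi :: "('a, 'm) ring_scheme \<Rightarrow> (nat \<Rightarrow> 'a) \<Rightarrow> (nat \<Rightarrow> 'a)" where
  "necklace_phi R x = (\<lambda>n\<in>{1..}. \<Oplus>\<^bsub>R\<^esub>d\<in>{d. d dvd n}. [d] \<cdot>\<^bsub>R\<^esub> x d)"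

definition necklace_supp :: "('a, 'm) ring_scheme \<Rightarrow> (nat \<Rightarrow> 'a) \<Rightarrow> nat set" where
  "necklace_supp R x = {n. n \<ge> 1 \<and> x n \<noteq> \<zero>\<^bsub>R\<^esub>}"

definition finite_support :: "('a, 'm) ring_scheme \<Rightarrow> (nat \<Rightarrow> 'a) \<Rightarrow> bool" where
  "finite_support R x \<longleftrightarrow> finite (necklace_supp R x)"

definition has_cycle :: "nat \<Rightarrow> (nat \<Rightarrow> 'a) \<Rightarrow> bool" where
  "has_cycle c a \<longleftrightarrow> (\<forall>i j. i \<ge> j \<and> j \<ge> 1 \<and> c dvd i - j \<longrightarrow> a i = a j)"

definition truncated_op :: "('a, 'm) ring_scheme \<Rightarrow> nat \<Rightarrow> (nat \<Rightarrow> 'a) \<Rightarrow> (nat \<Rightarrow> 'a)" where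
  "truncated_op R r x = (\<lambda>n\<in>{1..}. if n dvd r then x n else \<zero>\<^bsub>R\<^esub>)"

lemma necklace_phi_closed:
  assumes "cring R"
  shows "necklace_phi R \<in> carrier (necklace_ring R) \<rightarrow> carrier (sequence_ring R)"
proof
  interpret cring R by fact
  fix x assume "x \<in> carrier (necklace_ring R)"
  then have x: "x d \<in> carrier R" if "d \<ge> 1" for d
    using that PiE_mem[of x "{1..}" "\<lambda>_. carrier R" d]
    by (simp add: necklace_ring_def infinite_vectors_def)
  have "(\<Oplus>\<^bsub>R\<^esub>d\<in>{d. d dvd n}. [d] \<cdot>\<^bsub>R\<^esub> x d) \<in> carrier R" if "n \<ge> 1" for n :: nat
  proof (rule finsum_closed, rule Pi_I)
    fix d assume "d \<in> {d. d dvd n}"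
    then have "d \<noteq> 0" using that by (metis dvd_0_left_iff mem_Collect_eq not_one_le_zero)
    then have "x d \<in> carrier R" using x[of d] by simp
    then show "[d] \<cdot>\<^bsub>R\<^esub> x d \<in> carrier R" by (rule add.nat_pow_closed)
  qed
  then have "necklace_phi R x \<in> infinite_vectors R"
    unfolding necklace_phi_def infinite_vectors_def
    by (intro restrict_PiE_iff[THEN iffD2] ballI) (simp only: atLeast_iff)
  then show "necklace_phi R x \<in> carrier (sequence_ring R)"
    by (simp add: sequence_ring_def)
qed

lemma truncated_op_closed:
  assumes "cring R"
  shows "truncated_op R r \<in> carrier (necklace_ring R) \<rightarrow> carrier (necklace_ring R)"
proof
  interpret cring R by fact
  fix x assume "x \<in> carrier (necklace_ring R)"
  then have x: "x n \<in> carrier R" if "n \<in> {1..}" for n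
    using that PiE_mem[of x "{1..}" "\<lambda>_. carrier R" n]
    by (simp add: necklace_ring_def infinite_vectors_def)
  have "truncated_op R r x \<in> infinite_vectors R"
    unfolding truncated_op_def infinite_vectors_def
    by (intro restrict_PiE_iff[THEN iffD2] ballI) (simp only: x zero_closed split: if_split, simp)
  then show "truncated_op R r x \<in> carrier (necklace_ring R)"
    by (simp add: necklace_ring_def)
qed

end

theory Submission
  imports Defs "HOL-Number_Theory.Cong"
begin

text \<open>
  Write \<open>a\<close> for \<open>\<phi>(x)\<close>. If the support of \<open>x\<close> is finite with product \<open>N\<close>, then \<open>a\<^sub>n\<close> does not change
  when \<open>n\<close> is multiplied by some \<open>k\<close> coprime to \<open>N\<close>. Such a \<open>k\<close> can be chosen with
  \<open>n k \<equiv> (n, c)\<close> modulo \<open>c\<close>, so the \<open>c\<close>-cycle gives \<open>a\<^sub>n = a\<^bsub>(n, c)\<^esub>\<close>. For \<open>n\<close> not dividing \<open>c\<close>,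
  induction on \<open>n\<close> reduces the difference of the two sides to the single term \<open>n x\<^sub>n\<close>, and
  torsion-freeness yields \<open>x\<^sub>n = 0\<close>.
\<close>

lemma exists_cong_coprime_nat:
  fixes a m N :: nat
  assumes "coprime a m" and "m > 0" and "N > 0"
  obtains k where "[k = a] (mod m)" and "coprime k N" and "k > 0"
proof -
  \<comment> \<open>A prime divisor of \<open>N\<close> divides exactly one of \<open>a\<close> and \<open>t\<close>, hence never \<open>a + t * m\<close>.\<close>
  define t where "t = \<Prod>{p \<in> prime_factors N. \<not> p dvd a}"
  have dvd_t: "p dvd t \<longleftrightarrow> \<not> p dvd a" if "prime p" "p dvd N" for p
  proof -
    have "p dvd t \<longleftrightarrow> (\<exists>q \<in> {q \<in> prime_factors N. \<not> q dvd a}. p dvd q)"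
      using that unfolding t_def by (subst prime_dvd_prod_iff) auto
    also have "\<dots> \<longleftrightarrow> \<not> p dvd a"
      using that \<open>N > 0\<close> by (auto simp: prime_factors_dvd dest: primes_dvd_imp_eq)
    finally show ?thesis .
  qed
  have "t > 0"
    unfolding t_def by (intro prod_pos) (auto intro: prime_gt_0_nat)
  have "coprime (a + t * m) N"
  proof (rule ccontr)
    assume "\<not> coprime (a + t * m) N"
    then obtain p where p: "prime p" "p dvd a + t * m" "p dvd N"
      using prime_factor_nat[of "gcd (a + t * m) N"] by (auto simp: coprime_iff_gcd_eq_1)
    show False
    proof (cases "p dvd a")
      case True
      then have "p dvd t * m" using p(2) dvd_add_right_iff by blast
      then have "p dvd m" using True p(1) dvd_t[OF p(1,3)] prime_dvd_mult_nat by blast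
      then show False
        using coprime_common_divisor[OF \<open>coprime a m\<close> True] p(1) by auto
    next
      case False
      then have "p dvd t * m" using dvd_t[OF p(1,3)] by simp
      then show False using False p(2) dvd_add_left_iff by blast
    qed
  qed
  moreover have "[a + t * m = a] (mod m)"
    by (simp add: cong_def)
  moreover have "a + t * m > 0"
    using \<open>t > 0\<close> \<open>m > 0\<close> by simp
  ultimately show ?thesis
    by (intro that)
qed

text \<open>Dividing by \<open>g = gcd n c\<close> leaves coprime \<open>u\<close> and
  \<open>m\<close>. An inverse \<open>a\<close> of \<open>u\<close> modulo \<open>m\<close> is
  itself a unit, so its residue class contains a \<open>k\<close> coprime to \<open>N\<close>.
  Multiplying \<open>u * k \<equiv> 1\<close> by \<open>g\<close> raises the modulus from
  \<open>m\<close> to \<open>c\<close>.\<close>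

lemma exists_coprime_mult_cong_gcd_nat:
  fixes n c N :: nat
  assumes "n > 0" and "c > 0" and "N > 0"
  obtains k where "coprime k N" and "k > 0" and "[n * k = gcd n c] (mod c)"
proof -
  define g where "g = gcd n c"
  define u m where "u = n div g" and "m = c div g"
  have nc: "n = g * u" "c = g * m"
    by (simp_all add: g_def u_def m_def)
  then have "m > 0"
    using \<open>c > 0\<close> by (auto intro: Nat.gr0I)
  have "coprime u m"
    using assms by (auto simp: u_def m_def g_def intro: div_gcd_coprime)
  then obtain a where a: "[u * a = 1] (mod m)"
    using cong_solve_coprime_nat by auto
  then have "coprime a m"
    by (metis coprime_iff_invertible_nat mult.commute One_nat_def)
  then obtain k where k: "[k = a] (mod m)" "coprime k N" "k > 0"
    using exists_cong_coprime_nat[OF _ \<open>m > 0\<close> \<open>N > 0\<close>] by metis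
  have "[u * k = 1] (mod m)"
    using cong_trans[OF cong_scalar_left[OF k(1)] a] .
  then have "[g * (u * k) = g * 1] (mod (g * m))"
    by (simp only: cong_def mult_mod_right[symmetric])
  then have "[n * k = g] (mod c)"
    by (simp only: nc mult.assoc mult_1_right)
  then show ?thesis
    using that[OF k(2,3)] g_def by simp
qed

lemma necklace_ring_carrierD:
  assumes "x \<in> carrier (necklace_ring R)" and "n \<ge> 1"
  shows "x n \<in> carrier R"
  using assms PiE_mem[of x "{1..}" "\<lambda>_. carrier R" n]
  by (simp add: necklace_ring_def infinite_vectors_def)

lemma finite_support_truncated_op:
  assumes "c \<ge> 1"
  shows "finite_support R (truncated_op R c y)"
proof -
  have "necklace_supp R (truncated_op R c y) \<subseteq> {d. d dvd c}"
    by (auto simp: necklace_supp_def truncated_op_def split: if_splits)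
  then show ?thesis
    unfolding finite_support_def using assms by (auto intro: finite_subset)
qed

lemma truncated_op_eq_self:
  assumes "x \<in> carrier (necklace_ring R)" and "\<And>n. n \<ge> 1 \<Longrightarrow> \<not> n dvd c \<Longrightarrow> x n = \<zero>\<^bsub>R\<^esub>"
  shows "truncated_op R c x = x"
proof
  fix n
  show "truncated_op R c x n = x n"
    \<comment> \<open>At index 0 both sides are \<open>undefined\<close>: the left by restriction,
      the right because \<open>x\<close> is extensional.\<close>
    using assms PiE_arb[of x "{1..}" "\<lambda>_. carrier R" n]
    by (auto simp: truncated_op_def necklace_ring_def infinite_vectors_def)
qed

lemma (in ring) Z_torsion_freeD:
  assumes "Z_torsion_free R" and "n \<ge> (1::nat)" and "r \<in> carrier R" and "[n] \<cdot> r = \<zero>"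
  shows "r = \<zero>"
proof -
  have "[int n] \<cdot> r = [int n] \<cdot> \<zero>"
    using assms by (simp add: add_pow_int_ge)
  moreover have "inj_on (\<lambda>r. [int n] \<cdot> r) (carrier R)"
    using assms by (simp add: Z_torsion_free_def)
  ultimately show ?thesis
    using assms(3) by (blast dest: inj_onD)
qed

text \<open>Terms with \<open>x d = \<zero>\<close> drop out, so the index set may be cut down to
  \<open>A\<close>; this brings \<open>\<phi>\<close> at different indices to sums over comparable
  sets.\<close>

lemma (in cring) necklace_phi_eq_finsum:
  assumes x: "x \<in> carrier (necklace_ring R)" and "n \<ge> 1" and "A \<subseteq> {d. d dvd n}"
    and zero: "\<And>d. d dvd n \<Longrightarrow> d \<notin> A \<Longrightarrow> x d = \<zero>"
  shows "necklace_phi R x n = (\<Oplus>d\<in>A. [d] \<cdot> x d)"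
proof -
  have "d \<ge> 1" if "d dvd n" for d
    using that \<open>n \<ge> 1\<close> by (auto intro: Nat.gr0I simp: Suc_le_eq)
  moreover have "finite {d. d dvd n}"
    using \<open>n \<ge> 1\<close> by simp
  ultimately have "(\<Oplus>d\<in>A. [d] \<cdot> x d) = (\<Oplus>d\<in>{d. d dvd n}. [d] \<cdot> x d)"
    using \<open>A \<subseteq> {d. d dvd n}\<close> zero necklace_ring_carrierD[OF x]
    by (intro add.finprod_mono_neutral_cong_left) (assumption | auto)+
  then show ?thesis
    using \<open>n \<ge> 1\<close> by (simp add: necklace_phi_def)
qed

text \<open>A divisor of \<open>n * k\<close> in the support is coprime to \<open>k\<close>, hence
  divides \<open>n\<close>; no new nonzero terms arise.\<close>

lemma (in cring) necklace_phi_mult_coprime: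
  assumes x: "x \<in> carrier (necklace_ring R)" and "n \<ge> 1" and "k \<ge> 1"
    and cop: "\<And>d. d \<in> necklace_supp R x \<Longrightarrow> coprime k d"
  shows "necklace_phi R x (n * k) = necklace_phi R x n"
proof -
  have "x d = \<zero>" if "d dvd n * k" "\<not> d dvd n" for d
  proof (rule ccontr)
    assume "x d \<noteq> \<zero>"
    moreover have "d \<ge> 1"
      using that assms by (auto intro: Nat.gr0I simp: Suc_le_eq)
    ultimately have "coprime d k"
      using cop[of d] by (simp add: necklace_supp_def coprime_commute)
    then show False
      using that by (simp add: coprime_dvd_mult_left_iff)
  qed
  then have "necklace_phi R x (n * k) = (\<Oplus>d\<in>{d. d dvd n}. [d] \<cdot> x d)"
    using assms by (intro necklace_phi_eq_finsum) auto
  then show ?thesis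
    using \<open>n \<ge> 1\<close> by (simp add: necklace_phi_def)
qed

lemma (in cring) necklace_phi_gcd:
  assumes x: "x \<in> carrier (necklace_ring R)" and "c \<ge> 1" and "n \<ge> 1"
    and cyc: "has_cycle c (necklace_phi R x)" and fin: "finite_support R x"
  shows "necklace_phi R x n = necklace_phi R x (gcd n c)"
proof -
  \<comment> \<open>Every element of the finite support divides \<open>N\<close>, so one condition
    \<open>coprime k N\<close> covers them all.\<close>
  define N where "N = \<Prod>(necklace_supp R x)"
  have "N > 0"
    unfolding N_def by (intro prod_pos) (auto simp: necklace_supp_def)
  then obtain k where k: "coprime k N" "k > 0" "[n * k = gcd n c] (mod c)"
    using exists_coprime_mult_cong_gcd_nat[of n c N] assms by auto
  have "coprime k d" if "d \<in> necklace_supp R x" for d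
  proof -
    have "d dvd N"
      unfolding N_def using that fin by (auto simp: finite_support_def)
    then show ?thesis
      using k(1) by (meson coprime_divisors dvd_refl)
  qed
  then have "necklace_phi R x n = necklace_phi R x (n * k)"
    using assms k by (intro necklace_phi_mult_coprime[symmetric]) auto
  \<comment> \<open>\<open>has_cycle\<close> uses truncated subtraction and compares a larger index
    with a smaller one, so the order has to be known.\<close>
  also have "gcd n c \<le> n * k"
    using \<open>n \<ge> 1\<close> k(2) by (intro dvd_imp_le) auto
  then have "necklace_phi R x (n * k) = necklace_phi R x (gcd n c)"
    using cyc k(3) assms by (simp add: has_cycle_def cong_altdef_nat Suc_le_eq)
  finally show ?thesis .
qed

lemma (in cring) necklace_eq_zero_if_not_dvd:
  assumes tf: "Z_torsion_free R" and x: "x \<in> carrier (necklace_ring R)" and "c \<ge> 1"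
    and cyc: "has_cycle c (necklace_phi R x)" and fin: "finite_support R x"
    and "n \<ge> 1" and "\<not> n dvd c"
  shows "x n = \<zero>"
  using \<open>n \<ge> 1\<close> \<open>\<not> n dvd c\<close>
proof (induction n rule: less_induct)
  case (less n)
  let ?g = "gcd n c" and ?D = "{d. d dvd gcd n c}"
  have xc: "x d \<in> carrier R" if "d dvd n" for d
    using that less.prems by (intro necklace_ring_carrierD[OF x]) (auto intro: Nat.gr0I simp: Suc_le_eq)
  have finD: "finite ?D"
    using less.prems by simp
  \<comment> \<open>Such a \<open>d\<close> is a proper divisor of \<open>n\<close> and does not
    divide \<open>c\<close>, so the induction hypothesis applies.\<close>
  have "x d = \<zero>" if "d dvd n" "d \<notin> insert n ?D" for d
    using that less.prems by (intro less.IH) (auto simp: Suc_le_eq intro: Nat.gr0I dest: dvd_imp_le)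
  then have "necklace_phi R x n = (\<Oplus>d\<in>insert n ?D. [d] \<cdot> x d)"
    using less.prems finD by (intro necklace_phi_eq_finsum[OF x]) auto
  \<comment> \<open>Since \<open>n\<close> does not divide \<open>c\<close>, it lies outside
    \<open>?D\<close> and splits off as a separate term.\<close>
  also have "\<dots> = [n] \<cdot> x n \<oplus> (\<Oplus>d\<in>?D. [d] \<cdot> x d)"
    using less.prems finD xc by (intro finsum_insert) auto
  also have "(\<Oplus>d\<in>?D. [d] \<cdot> x d) = necklace_phi R x ?g"
    using less.prems by (simp add: necklace_phi_def Suc_le_eq)
  also have "\<dots> = necklace_phi R x n"
    using necklace_phi_gcd[OF x \<open>c \<ge> 1\<close> _ cyc fin] less.prems by simp
  finally have "necklace_phi R x n = [n] \<cdot> x n \<oplus> necklace_phi R x n" .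
  moreover have "necklace_phi R x n \<in> carrier R"
    using less.prems xc by (simp add: necklace_phi_def)
  ultimately have "[n] \<cdot> x n = \<zero>"
    using add.r_cancel_one'[OF _ add.nat_pow_closed[OF xc[OF dvd_refl]]] by blast
  then show ?case
    using Z_torsion_freeD[OF tf less.prems(1) xc[OF dvd_refl]] by simp
qed

theorem theorem3p26:
  fixes R :: "('a, 'm) ring_scheme" and c :: nat and x :: "nat \<Rightarrow> 'a"
  assumes "cring R" and "Z_torsion_free R" and "c \<ge> 1"
    and "x \<in> carrier (necklace_ring R)"
    and "has_cycle c (necklace_phi R x)"
  shows "finite_support R x \<longleftrightarrow> x \<in> truncated_op R c ` carrier (necklace_ring R)"
proof
  interpret cring R by fact
  assume "finite_support R x"
  \<comment> \<open>Vanishing off the divisors of \<open>c\<close> makes \<open>x\<close> its own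
    preimage.\<close>
  then have "truncated_op R c x = x"
    using assms by (intro truncated_op_eq_self necklace_eq_zero_if_not_dvd)
  then show "x \<in> truncated_op R c ` carrier (necklace_ring R)"
    using assms(4) by (metis imageI)
next
  assume "x \<in> truncated_op R c ` carrier (necklace_ring R)"
  then show "finite_support R x"
    using finite_support_truncated_op \<open>c \<ge> 1\<close> by blast
qed

end
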